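(* Let $q\ge1$ and let $\{M_1(t)\}_{t\ge0},\dots,\{M_q(t)\}_{t\ge0}$ be independent generalized counting processes, where $M_i$ has positive rates $\lambda_{i1},\dots,\lambda_{ik_i}$, and let $\{M_0(t)\}_{t\ge0}$ be a generalized counting process with positive rates $\mu_1,\dots,\mu_{k_0}$, independent of $(M_1,\dots,M_q)$. Let $\bar{\mathcal M}(t)=(M_1(M_0(t)),\dots,M_q(M_0(t)))$ and $\Lambda=\sum_{i=1}^{q}\sum_{j_i=1}^{k_i}\lambda_{ij_i}$. For every $\bar n=(n_1,\dots,n_q)\in\mathbb{N}_0^q$ and $t\ge0$, the probability mass function $\hat p_{\bar{\mathcal M}}(\bar n,t)=\mathrm{Pr}\{\bar{\mathcal M}(t)=\bar n\}$ is given by $$\hat p_{\bar{\mathcal M}}(\bar n,t)=\sum_{\substack{\Omega(k_i,n_i)\\ i=1,2,\dots,q}}\Big(\prod_{i=1}^{q}\prod_{j_i=1}^{k_i}\frac{(\lambda_{ij_i})^{n_{ij_i}}}{n_{ij_i}!}\Big)\sum_{m=0}^{\infty}m^{\sum_{i=1}^{q}\sum_{j_i=1}^{k_i}n_{ij_i}}\sum_{\Omega(k_0,m)}\prod_{j_0=1}^{k_0}\frac{(\mu_{j_0}e^{-j_0\Lambda}t)^{x_{j_0}}}{x_{j_0}!}e^{-\mu_{j_0}t}.$$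
   Context: A generalized counting process (GCP) $\{M(t)\}_{t\ge0}$ with positive rates $\lambda_1,\dots,\lambda_k$ is a right-continuous $\mathbb{N}_0$-valued process with $M(0)=0$ and stationary independent increments, whose probability generating function is $\mathbb{E}(u^{M(t)})=\exp\big(-t\sum_{j=1}^{k}\lambda_j(1-u^j)\big)$, $|u|\le1$. The process $\bar{\mathcal M}$ is called the multivariate IGCP. $\Omega(k_i,n_i)=\{(n_{i1},\dots,n_{ik_i})\in\mathbb{N}_0^{k_i}:\sum_{j_i=1}^{k_i}j_in_{ij_i}=n_i\}$ and the first sum is over all choices of one element from each $\Omega(k_i,n_i)$; $\Omega(k_0,m)=\{(x_1,\dots,x_{k_0})\in\mathbb{N}_0^{k_0}:\sum_{j_0=1}^{k_0}j_0x_{j_0}=m\}$. Convention $0^0=1$. *)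

theory Defs
  imports "HOL-Probability.Probability"
begin

text \<open>
  A process with values in the natural numbers is a family \<open>X :: real \<Rightarrow> 'a \<Rightarrow> nat\<close> on a
  probability space \<open>P\<close>; only the times \<open>t \<ge> 0\<close> matter.
\<close>

definition independent_increments :: "'a measure \<Rightarrow> (real \<Rightarrow> 'a \<Rightarrow> nat) \<Rightarrow> bool" where
  "independent_increments P X \<longleftrightarrow>
     (\<forall>(N::nat) (s :: nat \<Rightarrow> real).
        0 \<le> s 0 \<and> (\<forall>i<N. s i < s (Suc i)) \<longrightarrow>
        prob_space.indep_vars P (\<lambda>_. count_space (UNIV :: int set))
          (\<lambda>i \<omega>. int (X (s (Suc i)) \<omega>) - int (X (s i) \<omega>)) {..<N})"

text \<open>Increments are taken in \<open>int\<close>, because subtraction on \<open>nat\<close> truncates.\<close>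

definition stationary_increments :: "'a measure \<Rightarrow> (real \<Rightarrow> 'a \<Rightarrow> nat) \<Rightarrow> bool" where
  "stationary_increments P X \<longleftrightarrow>
     (\<forall>s\<ge>0. \<forall>s'\<ge>0. \<forall>h\<ge>0.
        distr P (count_space (UNIV :: int set)) (\<lambda>\<omega>. int (X (s + h) \<omega>) - int (X s \<omega>)) =
        distr P (count_space (UNIV :: int set)) (\<lambda>\<omega>. int (X (s' + h) \<omega>) - int (X s' \<omega>)))"

text \<open>
  The rates are \<open>lam 1, \<dots>, lam k\<close>. The path properties are required almost surely, which
  includes processes that have them for every \<open>\<omega>\<close>.
\<close>

definition gcp :: "'a measure \<Rightarrow> nat \<Rightarrow> (nat \<Rightarrow> real) \<Rightarrow> (real \<Rightarrow> 'a \<Rightarrow> nat) \<Rightarrow> bool" where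
  "gcp P k lam X \<longleftrightarrow>
     k \<ge> 1 \<and> (\<forall>j\<in>{1..k}. lam j > 0) \<and>
     (\<forall>t\<ge>0. X t \<in> measurable P (count_space UNIV)) \<and>
     (AE \<omega> in P. X 0 \<omega> = 0) \<and>
     (AE \<omega> in P. \<forall>t\<ge>0. continuous (at_right t) (\<lambda>s. X s \<omega>)) \<and>
     independent_increments P X \<and>
     stationary_increments P X \<and>
     (\<forall>t\<ge>0. \<forall>u::real. \<bar>u\<bar> \<le> 1 \<longrightarrow>
        integral\<^sup>L P (\<lambda>\<omega>. u ^ X t \<omega>) = exp (- t * (\<Sum>j=1..k. lam j * (1 - u ^ j))))"

text \<open>
  Independence of processes is independence of their trajectories as random elements of the
  product space over all times \<open>t \<ge> 0\<close>, i.e. of the sigma-algebras generated by the processes.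
\<close>

definition traj_space :: "(real \<Rightarrow> nat) measure" where
  "traj_space = PiM {0..} (\<lambda>_. count_space UNIV)"

definition traj :: "(real \<Rightarrow> 'a \<Rightarrow> nat) \<Rightarrow> 'a \<Rightarrow> real \<Rightarrow> nat" where
  "traj X \<omega> = (\<lambda>t\<in>{0..}. X t \<omega>)"

definition independent_processes ::
    "'a measure \<Rightarrow> nat \<Rightarrow> (nat \<Rightarrow> real \<Rightarrow> 'a \<Rightarrow> nat) \<Rightarrow> bool" where
  "independent_processes P q M \<longleftrightarrow>
     prob_space.indep_vars P (\<lambda>_. traj_space) (\<lambda>i. traj (M i)) {1..q}"

text \<open>
  \<open>M0\<close> is independent of the vector process \<open>(M 1, \<dots>, M q)\<close>. The constant \<open>indep_var\<close> needs
  both random elements to have the same type, hence the generated sigma-algebras.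
\<close>

definition independent_of_vector ::
    "'a measure \<Rightarrow> (real \<Rightarrow> 'a \<Rightarrow> nat) \<Rightarrow> nat \<Rightarrow> (nat \<Rightarrow> real \<Rightarrow> 'a \<Rightarrow> nat) \<Rightarrow> bool" where
  "independent_of_vector P M0 q M \<longleftrightarrow>
     prob_space.indep_set P
       (sets (vimage_algebra (space P) (traj M0) traj_space))
       (sets (vimage_algebra (space P) (\<lambda>\<omega>. \<lambda>i\<in>{1..q}. traj (M i) \<omega>)
          (PiM {1..q} (\<lambda>_. traj_space))))"

definition multivariate_igcp ::
    "nat \<Rightarrow> (nat \<Rightarrow> real \<Rightarrow> 'a \<Rightarrow> nat) \<Rightarrow> (real \<Rightarrow> 'a \<Rightarrow> nat) \<Rightarrow> real \<Rightarrow> 'a \<Rightarrow> nat \<Rightarrow> nat" where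
  "multivariate_igcp q M M0 t \<omega> = (\<lambda>i\<in>{1..q}. M i (real (M0 t \<omega>)) \<omega>)"

text \<open>Tuples indexed by \<open>1, \<dots>, k\<close> are extensional functions, so that this set is finite.\<close>

definition Omega :: "nat \<Rightarrow> nat \<Rightarrow> (nat \<Rightarrow> nat) set" where
  "Omega k n = {x \<in> {1..k} \<rightarrow>\<^sub>E UNIV. (\<Sum>j=1..k. j * x j) = n}"

end

theory Submission
  imports Defs
begin

text \<open>
  Expanding the probability generating function of a generalized counting process as a product of
  exponential series and comparing coefficients of powers of \<open>u\<close> gives its mass function as a sum
  over \<open>Omega k n\<close>. Conditioning on \<open>M0 t = m\<close> reduces the theorem to these one-dimensional laws:
  the mass functions of \<open>M 1, \<dots>, M q\<close> at time \<open>m\<close> contribute the powers of \<open>m\<close> and a common factor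
  \<open>exp (- m Lam)\<close>, which is absorbed into the weights of \<open>M0\<close> because \<open>m = \<Sum>j. j * x j\<close> on
  \<open>Omega k0 m\<close>. All terms are nonnegative with a finite total, so the two sums may be swapped.
\<close>

section \<open>Mass function of a generalized counting process\<close>

lemma finite_Omega: "finite (Omega k n)"
proof (rule finite_subset)
  show "Omega k n \<subseteq> {1..k} \<rightarrow>\<^sub>E {..n}"
  proof
    fix x assume x: "x \<in> Omega k n"
    have "x j \<le> n" if "j \<in> {1..k}" for j
    proof -
      have "x j \<le> j * x j"
        using that by simp
      also have "\<dots> \<le> (\<Sum>j=1..k. j * x j)"
        using that by (intro member_le_sum) auto
      finally show ?thesis
        using x by (simp add: Omega_def)
    qed
    thus "x \<in> {1..k} \<rightarrow>\<^sub>E {..n}"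
      using x by (auto simp: Omega_def PiE_iff)
  qed
qed (auto intro: finite_PiE)

lemma exp_powser_has_sum:
  fixes x :: real
  shows "((\<lambda>n. x ^ n / fact n) has_sum exp x) UNIV"
proof (rule norm_summable_imp_has_sum)
  show "summable (\<lambda>n. norm (x ^ n / fact n))"
    using summable_norm_exp[of x] by (simp add: divide_inverse mult.commute)
  show "(\<lambda>n. x ^ n / fact n) sums exp x"
    using exp_converges[of x] by (simp add: divide_inverse mult.commute)
qed

text \<open>Each factor \<open>exp (- c j * (1 - u ^ j))\<close> is \<open>exp (- c j)\<close> times
  the exponential series in \<open>c j * u ^ j\<close>. The product of these absolutely convergent
  series is a sum over all tuples, and collecting the tuples with the same weight
  \<open>\<Sum>j. j * x j = n\<close> gives the coefficient of \<open>u ^ n\<close>.\<close>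

lemma exp_prod_powser_sums:
  fixes c :: "nat \<Rightarrow> real"
  shows "(\<lambda>n. (\<Sum>x\<in>Omega k n. \<Prod>j=1..k. c j ^ x j / fact (x j) * exp (- c j)) * u ^ n)
           sums exp (- (\<Sum>j=1..k. c j * (1 - u ^ j)))"
proof -
  define f where "f = (\<lambda>j a. (c j * u ^ j) ^ a / fact a * exp (- c j))"
  define F where "F = (\<lambda>x. \<Prod>j=1..k. f j (x j))"
  let ?E = "exp (- (\<Sum>j=1..k. c j * (1 - u ^ j)))"
  have f: "(f j has_sum exp (- (c j * (1 - u ^ j)))) UNIV" for j
  proof -
    have "(f j has_sum (exp (c j * u ^ j) * exp (- c j))) UNIV"
      unfolding f_def by (intro has_sum_cmult_left exp_powser_has_sum)
    thus ?thesis
      by (simp add: algebra_simps flip: exp_add)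
  qed
  have abs: "(\<lambda>a. norm (f j a)) summable_on UNIV" for j
    using f[of j] by (metis summable_on_def summable_on_iff_abs_summable_on_real)
  have "infsum F ({1..k} \<rightarrow>\<^sub>E UNIV) = (\<Prod>j=1..k. infsum (f j) UNIV)"
    unfolding F_def by (rule infsum_prod_PiE_abs) (use abs in auto)
  also have "\<dots> = (\<Prod>j=1..k. exp (- (c j * (1 - u ^ j))))"
    by (intro prod.cong refl infsumI f)
  also have "\<dots> = ?E"
    by (simp add: sum_negf flip: exp_sum)
  finally have *: "infsum F ({1..k} \<rightarrow>\<^sub>E UNIV) = ?E" .
  \<comment> \<open>\<open>infsum\<close> of a non-summable family is 0, so summability follows from the value.\<close>
  hence "F summable_on ({1..k} \<rightarrow>\<^sub>E UNIV)"
    using infsum_not_exists[of F "{1..k} \<rightarrow>\<^sub>E UNIV"] by fastforce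
  hence "(F has_sum ?E) ({1..k} \<rightarrow>\<^sub>E UNIV)"
    using * by (metis has_sum_infsum)
  \<comment> \<open>A tuple determines its weight, so it lies in \<open>Omega k n\<close> for
    exactly one \<open>n\<close>: \<open>snd\<close> is injective on the disjoint union, and the sum
    can be taken first over each \<open>Omega k n\<close>.\<close>
  also have "({1..k} \<rightarrow>\<^sub>E UNIV) = snd ` Sigma UNIV (Omega k)"
    by (force simp: Omega_def)
  finally have "((F \<circ> snd) has_sum ?E) (Sigma UNIV (Omega k))"
    by (subst (asm) has_sum_reindex) (auto simp: inj_on_def Omega_def)
  hence "((\<lambda>n. \<Sum>x\<in>Omega k n. F x) has_sum ?E) UNIV"
    by (rule has_sum_SigmaD) (auto intro!: has_sum_finite finite_Omega)
  hence "(\<lambda>n. \<Sum>x\<in>Omega k n. F x) sums ?E"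
    by (rule has_sum_imp_sums)
  moreover have "(\<Sum>x\<in>Omega k n. F x) =
      (\<Sum>x\<in>Omega k n. \<Prod>j=1..k. c j ^ x j / fact (x j) * exp (- c j)) * u ^ n" for n
    unfolding sum_distrib_right
  proof (rule sum.cong[OF refl])
    fix x assume "x \<in> Omega k n"
    hence "u ^ n = (\<Prod>j=1..k. (u ^ j) ^ x j)"
      by (auto simp: Omega_def power_sum simp flip: power_mult)
    thus "F x = (\<Prod>j=1..k. c j ^ x j / fact (x j) * exp (- c j)) * u ^ n"
      by (simp add: F_def f_def power_mult_distrib prod.distrib prod_dividef)
  qed
  ultimately show ?thesis by simp
qed

text \<open>Once the coefficients below \<open>n\<close> vanish, dividing by \<open>u ^ n\<close>
  for nonzero \<open>u\<close> leaves a series that starts with \<open>d n\<close> and has value 0;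
  letting u tend to 0 yields \<open>d n = 0\<close>. The limit ignores the point 0 itself, where the
  division fails.\<close>

lemma powser_eq_0_imp_coeffs_eq_0:
  fixes d :: "nat \<Rightarrow> 'a::{real_normed_field,banach}"
  assumes "0 < r" and sums: "\<And>u. norm u < r \<Longrightarrow> (\<lambda>n. d n * u ^ n) sums 0"
  shows "d n = 0"
proof (induction n rule: less_induct)
  case (less n)
  have "(\<lambda>i. d (i + n) * u ^ i) sums 0" if "u \<noteq> 0" "norm u < r" for u
  proof -
    have "(\<lambda>i. d (i + n) * u ^ (i + n)) sums 0"
      using sums[OF that(2)] less by (subst sums_iff_shift) simp
    hence "(\<lambda>i. d (i + n) * u ^ (i + n) / u ^ n) sums (0 / u ^ n)"
      by (rule sums_divide)
    thus ?thesis
      using that by (simp add: power_add)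
  qed
  from powser_limit_0_strong[OF \<open>0 < r\<close> this]
  show ?case
    by (simp add: tendsto_const_iff)
qed

text \<open>Expectation and series are exchanged by domination: the term of index \<open>n\<close>
  has absolute expectation at most \<open>\<bar>u\<bar> ^ n\<close>, a summable bound because the
  inequality \<open>\<bar>u\<bar> < 1\<close> is strict.\<close>

lemma (in prob_space) pgf_sums:
  fixes X :: "'a \<Rightarrow> nat" and u :: real
  assumes X [measurable]: "X \<in> measurable M (count_space UNIV)" and "\<bar>u\<bar> < 1"
  shows "(\<lambda>n. prob {\<omega> \<in> space M. X \<omega> = n} * u ^ n) sums (\<integral>\<omega>. u ^ X \<omega> \<partial>M)"
proof -
  define A where "A = (\<lambda>n. {\<omega> \<in> space M. X \<omega> = n})"
  have [measurable]: "A n \<in> sets M" for n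
    unfolding A_def by measurable
  let ?f = "\<lambda>n \<omega>. indicator (A n) \<omega> * u ^ n"
  \<comment> \<open>For a fixed outcome the series has a single nonzero term, the one with
    \<open>n = X \<omega>\<close>.\<close>
  have single: "?f n \<omega> = (if n = X \<omega> then u ^ n else 0)" if "\<omega> \<in> space M" for n \<omega>
    using that by (auto simp: A_def)
  have "(\<lambda>n. \<integral>\<omega>. ?f n \<omega> \<partial>M) sums (\<integral>\<omega>. (\<Sum>n. ?f n \<omega>) \<partial>M)"
  proof (rule sums_integral)
    show "integrable M (?f n)" for n
      by (intro integrable_mult_left integrable_real_indicator) (auto simp: emeasure_eq_measure)
    show "AE \<omega> in M. summable (\<lambda>n. norm (?f n \<omega>))"
      by (rule AE_I2, rule summable_finite[of "{X _}"]) (auto simp: single)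
    show "summable (\<lambda>n. \<integral>\<omega>. norm (?f n \<omega>) \<partial>M)"
    proof (rule summable_comparison_test[OF exI[of _ 0]], safe)
      show "summable (\<lambda>n. \<bar>u\<bar> ^ n)"
        using assms(2) by simp
      fix n
      have "prob (A n) * \<bar>u\<bar> ^ n \<le> 1 * \<bar>u\<bar> ^ n"
        by (intro mult_right_mono) auto
      thus "norm (\<integral>\<omega>. norm (?f n \<omega>) \<partial>M) \<le> \<bar>u\<bar> ^ n"
        by (simp add: abs_mult power_abs)
    qed
  qed
  moreover have "(\<integral>\<omega>. (\<Sum>n. ?f n \<omega>) \<partial>M) = (\<integral>\<omega>. u ^ X \<omega> \<partial>M)"
    by (intro Bochner_Integration.integral_cong refl) (simp add: single sums_unique[OF sums_single, symmetric])
  ultimately show ?thesis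
    by (simp add: A_def)
qed

text \<open>Both sides are the coefficients of the same generating function, with
  \<open>c j = lam j * t\<close>; their difference is a power series that vanishes for
  \<open>\<bar>u\<bar> < 1\<close>.\<close>

lemma (in prob_space) gcp_pmf:
  assumes "gcp M k lam X" "t \<ge> 0"
  shows "prob {\<omega> \<in> space M. X t \<omega> = n} =
    (\<Sum>x\<in>Omega k n. \<Prod>j=1..k. (lam j * t) ^ x j / fact (x j) * exp (- lam j * t))"
proof -
  let ?p = "\<lambda>n. prob {\<omega> \<in> space M. X t \<omega> = n}"
  let ?a = "\<lambda>n. \<Sum>x\<in>Omega k n. \<Prod>j=1..k. (lam j * t) ^ x j / fact (x j) * exp (- (lam j * t))"
  have "(\<lambda>n. (?p n - ?a n) * u ^ n) sums 0" if "norm u < 1" for u :: real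
  proof -
    have meas: "X t \<in> measurable M (count_space UNIV)"
      and "(\<integral>\<omega>. u ^ X t \<omega> \<partial>M) = exp (- t * (\<Sum>j=1..k. lam j * (1 - u ^ j)))"
      using assms that by (auto simp: gcp_def)
    hence "(\<integral>\<omega>. u ^ X t \<omega> \<partial>M) = exp (- (\<Sum>j=1..k. lam j * t * (1 - u ^ j)))"
      by (simp add: sum_distrib_left sum_negf mult_ac)
    with pgf_sums[OF meas, of u] that
    have "(\<lambda>n. ?p n * u ^ n) sums exp (- (\<Sum>j=1..k. lam j * t * (1 - u ^ j)))"
      by simp
    from sums_diff[OF this exp_prod_powser_sums[where c = "\<lambda>j. lam j * t" and k = k and u = u]]
    show ?thesis
      by (simp add: left_diff_distrib)
  qed
  from powser_eq_0_imp_coeffs_eq_0[OF zero_less_one this, of n]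
  show ?thesis by simp
qed

section \<open>From independent trajectories to independent events at fixed times\<close>

lemma measurable_traj_space_component:
  "0 \<le> t \<Longrightarrow> {f \<in> space traj_space. f t = m} \<in> sets traj_space"
  unfolding traj_space_def by measurable

lemma traj_in_space: "traj X \<omega> \<in> space traj_space"
  by (simp add: traj_def traj_space_def space_PiM)

lemma (in prob_space) prob_independent_processes:
  assumes "independent_processes M q X" "q \<ge> 1" "s \<ge> 0"
  shows "prob {\<omega> \<in> space M. \<forall>i\<in>{1..q}. X i s \<omega> = n i} =
    (\<Prod>i=1..q. prob {\<omega> \<in> space M. X i s \<omega> = n i})"
proof -
  let ?A = "\<lambda>i. {f \<in> space traj_space. f s = n i}"
  have *: "traj (X i) -` ?A i \<inter> space M = {\<omega> \<in> space M. X i s \<omega> = n i}" for i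
    using \<open>s \<ge> 0\<close> traj_in_space[of "X i"] by (auto simp: traj_def)
  have "prob (\<Inter>i\<in>{1..q}. traj (X i) -` ?A i \<inter> space M) =
      (\<Prod>i\<in>{1..q}. prob (traj (X i) -` ?A i \<inter> space M))"
    using assms by (intro indep_varsD_finite[where M' = "\<lambda>_. traj_space"])
      (auto simp: independent_processes_def intro: measurable_traj_space_component)
  also have "(\<Inter>i\<in>{1..q}. traj (X i) -` ?A i \<inter> space M) =
      {\<omega> \<in> space M. \<forall>i\<in>{1..q}. X i s \<omega> = n i}"
    \<comment> \<open>An intersection over no indices would be \<open>UNIV\<close> instead of
      \<open>space M\<close>, hence \<open>q \<ge> 1\<close>.\<close>
    unfolding * using \<open>q \<ge> 1\<close> by fastforce
  finally show ?thesis
    unfolding * .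
qed

lemma (in prob_space) prob_independent_of_vector:
  assumes "independent_of_vector M X0 q X" "s \<ge> 0" "t \<ge> 0"
  shows "prob {\<omega> \<in> space M. X0 t \<omega> = m \<and> (\<forall>i\<in>{1..q}. X i s \<omega> = n i)} =
    prob {\<omega> \<in> space M. X0 t \<omega> = m} * prob {\<omega> \<in> space M. \<forall>i\<in>{1..q}. X i s \<omega> = n i}"
proof -
  let ?V = "\<lambda>\<omega>. \<lambda>i\<in>{1..q}. traj (X i) \<omega>"
  define A where "A = {f \<in> space traj_space. f t = m}"
  \<comment> \<open>A box of one-time cylinders, so that the joint event is the preimage of a
    measurable set under the vector of trajectories.\<close>
  define B where "B = (\<Pi>\<^sub>E i\<in>{1..q}. {f \<in> space traj_space. f s = n i})"
  have A: "traj X0 -` A \<inter> space M = {\<omega> \<in> space M. X0 t \<omega> = m}"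
    using \<open>t \<ge> 0\<close> traj_in_space[of X0] by (auto simp: A_def traj_def)
  have B: "?V -` B \<inter> space M = {\<omega> \<in> space M. \<forall>i\<in>{1..q}. X i s \<omega> = n i}"
    using \<open>s \<ge> 0\<close> traj_in_space by (auto simp: B_def PiE_iff) (auto simp: traj_def)
  have "A \<in> sets traj_space" "B \<in> sets (PiM {1..q} (\<lambda>_. traj_space))"
    using assms unfolding A_def B_def
    by (auto intro!: sets_PiM_I_finite measurable_traj_space_component)
  have "traj X0 -` A \<inter> space M \<in> sets (vimage_algebra (space M) (traj X0) traj_space)"
    by (rule in_vimage_algebra) fact
  moreover have "?V -` B \<inter> space M \<in> sets (vimage_algebra (space M) ?V (PiM {1..q} (\<lambda>_. traj_space)))"
    by (rule in_vimage_algebra) fact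
  ultimately have "prob ((traj X0 -` A \<inter> space M) \<inter> (?V -` B \<inter> space M)) =
      prob (traj X0 -` A \<inter> space M) * prob (?V -` B \<inter> space M)"
    using assms(1) unfolding independent_of_vector_def by (intro indep_setD)
  thus ?thesis
    unfolding A B by (simp add: Collect_conj_eq Int_ac)
qed

section \<open>Evaluation at the random time\<close>

text \<open>The extra factors multiply to \<open>exp (- c * (\<Sum>j. j * x j))\<close>, whose
  exponent is constant on \<open>Omega k m\<close>.\<close>

lemma gcp_weight_scale:
  assumes "x \<in> Omega k m"
  shows "(\<Prod>j=1..k. (mu j * exp (- real j * c) * t) ^ x j / fact (x j) * exp (- mu j * t)) =
    exp (- real m * c) * (\<Prod>j=1..k. (mu j * t) ^ x j / fact (x j) * exp (- mu j * t))"
proof -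
  have "real m = (\<Sum>j=1..k. real (j * x j))"
    using assms by (auto simp: Omega_def simp del: of_nat_mult simp flip: of_nat_sum)
  hence "exp (- real m * c) = exp (\<Sum>j=1..k. real (x j) * (- real j * c))"
    by (simp add: sum_distrib_left sum_distrib_right sum_negf mult_ac)
  also have "\<dots> = (\<Prod>j=1..k. exp (- real j * c) ^ x j)"
    by (simp add: exp_sum flip: exp_of_nat_mult)
  finally show ?thesis
    by (simp add: power_mult_distrib mult_ac flip: prod.distrib)
qed

theorem theorem4p3:
  fixes P :: "'a measure"
    and q :: nat
    and k :: "nat \<Rightarrow> nat" and lam :: "nat \<Rightarrow> nat \<Rightarrow> real"
    and k0 :: nat and mu :: "nat \<Rightarrow> real"
    and M :: "nat \<Rightarrow> real \<Rightarrow> 'a \<Rightarrow> nat" and M0 :: "real \<Rightarrow> 'a \<Rightarrow> nat"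
    and Lam :: real and n :: "nat \<Rightarrow> nat" and t :: real
  assumes "prob_space P"
    and "q \<ge> 1"
    and "\<And>i. i \<in> {1..q} \<Longrightarrow> gcp P (k i) (lam i) (M i)"
    and "gcp P k0 mu M0"
    and "independent_processes P q M"
    and "independent_of_vector P M0 q M"
    and "Lam = (\<Sum>i=1..q. \<Sum>j=1..k i. lam i j)"
    and "n \<in> {1..q} \<rightarrow>\<^sub>E UNIV"
    and "t \<ge> 0"
  shows "(\<forall>\<nu> \<in> (\<Pi>\<^sub>E i\<in>{1..q}. Omega (k i) (n i)).
            summable (\<lambda>m. real m ^ (\<Sum>i=1..q. \<Sum>j=1..k i. \<nu> i j) *
              (\<Sum>x\<in>Omega k0 m. \<Prod>j=1..k0.
                 (mu j * exp (- real j * Lam) * t) ^ x j / fact (x j) * exp (- mu j * t)))) \<and>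
         measure P {\<omega> \<in> space P. multivariate_igcp q M M0 t \<omega> = n} =
         (\<Sum>\<nu> \<in> (\<Pi>\<^sub>E i\<in>{1..q}. Omega (k i) (n i)).
            (\<Prod>i=1..q. \<Prod>j=1..k i. lam i j ^ \<nu> i j / fact (\<nu> i j)) *
            (\<Sum>m. real m ^ (\<Sum>i=1..q. \<Sum>j=1..k i. \<nu> i j) *
              (\<Sum>x\<in>Omega k0 m. \<Prod>j=1..k0.
                 (mu j * exp (- real j * Lam) * t) ^ x j / fact (x j) * exp (- mu j * t))))"
proof -
  interpret prob_space P by fact
  let ?N = "\<Pi>\<^sub>E i\<in>{1..q}. Omega (k i) (n i)"
  define S where "S = (\<lambda>m. \<Sum>x\<in>Omega k0 m. \<Prod>j=1..k0.
      (mu j * exp (- real j * Lam) * t) ^ x j / fact (x j) * exp (- mu j * t))"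
  define T where "T = (\<lambda>\<nu> m. real m ^ (\<Sum>i=1..q. \<Sum>j=1..k i. \<nu> i j) * S m)"
  define C where "C = (\<lambda>\<nu>. \<Prod>i=1..q. \<Prod>j=1..k i. lam i j ^ \<nu> i j / fact (\<nu> i j))"
  \<comment> \<open>On the event \<open>M0 t = m\<close> the random time is the constant
    \<open>m\<close>, so \<open>E m\<close> involves the outer processes only at a deterministic
    time.\<close>
  define E where "E = (\<lambda>m. {\<omega> \<in> space P. M0 t \<omega> = m \<and> (\<forall>i\<in>{1..q}. M i (real m) \<omega> = n i)})"

  have S: "S m = exp (- real m * Lam) * prob {\<omega> \<in> space P. M0 t \<omega> = m}" for m
    unfolding S_def gcp_pmf[OF assms(4,9)] sum_distrib_left
    by (intro sum.cong refl gcp_weight_scale)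
  have T_nonneg: "T \<nu> m \<ge> 0" for \<nu> m
    by (simp add: T_def S)
  have C_pos: "C \<nu> > 0" for \<nu>
    using assms(3) unfolding C_def gcp_def by (intro prod_pos ballI divide_pos_pos zero_less_power) auto
  have finN: "finite ?N"
    by (intro finite_PiE finite_Omega) auto

  have vector: "prob {\<omega> \<in> space P. \<forall>i\<in>{1..q}. M i (real m) \<omega> = n i} =
      (\<Sum>\<nu>\<in>?N. C \<nu> * real m ^ (\<Sum>i=1..q. \<Sum>j=1..k i. \<nu> i j)) * exp (- real m * Lam)" for m
  proof -
    have "prob {\<omega> \<in> space P. \<forall>i\<in>{1..q}. M i (real m) \<omega> = n i} =
        (\<Prod>i=1..q. prob {\<omega> \<in> space P. M i (real m) \<omega> = n i})"
      using assms by (intro prob_independent_processes) auto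
    also have "\<dots> = (\<Prod>i=1..q. \<Sum>x\<in>Omega (k i) (n i).
        \<Prod>j=1..k i. (lam i j * real m) ^ x j / fact (x j) * exp (- lam i j * real m))"
      by (intro prod.cong refl gcp_pmf assms(3)) auto
    \<comment> \<open>Distributivity: a product of sums is a sum over the choices \<nu> of one tuple
      from each \<open>Omega (k i) (n i)\<close>.\<close>
    also have "\<dots> = (\<Sum>\<nu>\<in>?N. \<Prod>i=1..q.
        \<Prod>j=1..k i. (lam i j * real m) ^ \<nu> i j / fact (\<nu> i j) * exp (- lam i j * real m))"
      by (intro prod_sum_PiE finite_Omega) auto
    \<comment> \<open>The powers of \<open>real m\<close> are collected into one. At
      \<open>m = 0\<close> this relies on \<open>0 ^ 0 = 1\<close>.\<close>
    also have "\<dots> = (\<Sum>\<nu>\<in>?N. C \<nu> * real m ^ (\<Sum>i=1..q. \<Sum>j=1..k i. \<nu> i j) *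
        (\<Prod>i=1..q. \<Prod>j=1..k i. exp (- lam i j * real m)))"
      by (simp add: C_def power_mult_distrib power_sum mult_ac flip: prod.distrib)
    also have "(\<Prod>i=1..q. \<Prod>j=1..k i. exp (- lam i j * real m)) = exp (- real m * Lam)"
      by (simp add: assms(7) sum_distrib_left sum_negf mult_ac flip: exp_sum)
    finally show ?thesis
      by (simp add: sum_distrib_right)
  qed
  \<comment> \<open>The factor \<open>exp (- real m * Lam)\<close> from \<open>vector\<close> and
    the probability of \<open>M0 t = m\<close> combine to exactly \<open>S m\<close>.\<close>
  have prob_E: "prob (E m) = (\<Sum>\<nu>\<in>?N. C \<nu> * T \<nu> m)" for m
    using prob_independent_of_vector[OF assms(6), of "real m" t m n] assms(9)
    unfolding E_def T_def S vector by (simp add: sum_distrib_left sum_distrib_right mult_ac)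

  have [measurable]: "M0 t \<in> measurable P (count_space UNIV)"
    using assms(4,9) by (simp add: gcp_def)
  have [measurable]: "M i (real m) \<in> measurable P (count_space UNIV)" if "i \<in> {1..q}" for i m
    using assms(3)[OF that] by (simp add: gcp_def)
  have "E m \<in> sets P" for m
    unfolding E_def by measurable
  hence "(\<lambda>m. prob (E m)) sums prob (\<Union>m. E m)"
    by (intro finite_measure_UNION) (auto simp: disjoint_family_on_def E_def)
  \<comment> \<open>Both \<open>n\<close> and the process vector are extensional on
    \<open>{1..q}\<close>, so agreement on these coordinates is equality of functions.\<close>
  also have "(\<Union>m. E m) = {\<omega> \<in> space P. multivariate_igcp q M M0 t \<omega> = n}"
    using assms(8) by (auto simp: E_def multivariate_igcp_def fun_eq_iff PiE_iff extensional_def)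
  finally have sums: "(\<lambda>m. \<Sum>\<nu>\<in>?N. C \<nu> * T \<nu> m) sums
      prob {\<omega> \<in> space P. multivariate_igcp q M M0 t \<omega> = n}"
    by (simp add: prob_E)

  have summable: "summable (T \<nu>)" if "\<nu> \<in> ?N" for \<nu>
  proof -
    \<comment> \<open>By nonnegativity each summand is bounded by the whole finite sum, whose series
      converges to a probability. Strict positivity of \<open>C \<nu>\<close> then allows it to be
      cancelled.\<close>
    have "summable (\<lambda>m. C \<nu> * T \<nu> m)"
    proof (rule summable_comparison_test[OF exI[of _ 0]], safe)
      show "summable (\<lambda>m. \<Sum>\<nu>\<in>?N. C \<nu> * T \<nu> m)"
        using sums by (rule sums_summable)
      show "norm (C \<nu> * T \<nu> m) \<le> (\<Sum>\<nu>\<in>?N. C \<nu> * T \<nu> m)" for m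
        using that finN T_nonneg C_pos
        by (auto simp: abs_mult less_imp_le intro!: member_le_sum mult_nonneg_nonneg)
    qed
    thus ?thesis
      using C_pos[of \<nu>] by simp
  qed
  \<comment> \<open>The outer sum is finite, so summability of each \<open>T \<nu>\<close> suffices
    for the exchange; the two limits agree by uniqueness.\<close>
  have "prob {\<omega> \<in> space P. multivariate_igcp q M M0 t \<omega> = n} = (\<Sum>\<nu>\<in>?N. C \<nu> * (\<Sum>m. T \<nu> m))"
    using summable by (intro sums_unique2[OF sums] sums_sum sums_mult summable_sums)
  with summable show ?thesis
    unfolding T_def S_def C_def by blast
qed

end
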